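(* Consider a family of numbers $S(n,k)$, indexed by all $n,k\in\mathbb{Z}$, that satisfies the recursion $$n\,S(n,k)=n\,S(n-1,k)+S(n,k-1)\qquad (n,k\in\mathbb{Z})$$ and the initial conditions $$S(n,-1)=\delta_{n,1}\quad (n\in\mathbb{Z}),\qquad S(-1,k)=\delta_{k,1}\quad (k\in\mathbb{Z}).$$ Then these conditions give a well-defined number $S(n,k)$ for all $n,k\in\mathbb{Z}$ (i.e. there is exactly one such family $S:\mathbb{Z}\times\mathbb{Z}\to\mathbb{Q}$), and for all integers $n\ge 1$, $k\ge 0$ it agrees with the harmonic multiset number $$S(n,k)=[t^k]\ \prod_{j=1}^n \frac{1}{1-t/j}.$$ The Stirling numbers are special cases: for all integers $n\ge 1$, $k\ge 0$, $$\left\{{n\atop k}\right\}=\frac{(-1)^{k+1}}{k!}\,S(k,-n),\qquad \left[{n\atop k}\right]=(n-1)!\;S(-n,k).$$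
   Context: $\delta_{i,j}$ is the Kronecker delta and $[t^k]$ extracts the coefficient of $t^k$. For $n\ge1,k\ge 0$ the harmonic multiset number is the complete homogeneous symmetric polynomial $h_k(1,\tfrac12,\dots,\tfrac1n)=\sum_{1\le j_1\le\cdots\le j_k\le n}\frac{1}{j_1\cdots j_k}$ (with $h_0=1$), equivalently the coefficient of $t^k$ in $\prod_{j=1}^n \frac{1}{1-t/j}$. The Stirling subset numbers $\left\{{n\atop k}\right\}$ (number of partitions of an $n$-element set into $k$ nonempty subsets) and the Stirling cycle numbers $\left[{n\atop k}\right]$ (number of ways to arrange $n$ elements into $k$ cycles) satisfy, for $k\ge 0$, $(e^t-1)^k=\sum_{n\ge0}\frac{k!}{n!}\left\{{n\atop k}\right\}t^n$ and $(-\log(1-t))^k=\sum_{n\ge0}\frac{k!}{n!}\left[{n\atop k}\right]t^n$. *)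

theory Defs
  imports "HOL-Computational_Algebra.Formal_Power_Series" "HOL-Combinatorics.Stirling"
begin

definition harmonic_family :: "(int \<Rightarrow> int \<Rightarrow> rat) \<Rightarrow> bool" where
  "harmonic_family S \<longleftrightarrow>
     (\<forall>n k. of_int n * S n k = of_int n * S (n - 1) k + S n (k - 1)) \<and>
     (\<forall>n. S n (-1) = (if n = 1 then 1 else 0)) \<and>
     (\<forall>k. S (-1) k = (if k = 1 then 1 else 0))"

end

theory Submission
  imports Defs
begin

text \<open>
  The two initial conditions fix a column, \<open>k = -1\<close>, and a row, \<open>n = -1\<close>; the third piece of data is
  hidden in the recursion, which at \<open>n = 0\<close> degenerates and forces \<open>S(0,k) = 0\<close> for all \<open>k\<close>. This
  zero row separates the plane into two independent problems. Above it, each row is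
  obtained from the one before it by moving away from the column \<open>k = -1\<close> in both directions;
  below it, each row is obtained outright from the one above it, starting with \<open>n = -1\<close>.

  Hence a family is unique (\<open>harmonic_family_unique\<close>: the difference of two families solves the
  homogeneous problem, whose only solution is zero). For existence it is then enough to exhibit one
  solution, and the claimed formulas already provide it on three quadrants: after rescaling,
  the recursion is the recurrence of the complete homogeneous polynomials for \<open>n \<ge> 1, k \<ge> 0\<close>,
  that of the Stirling subset numbers for \<open>n \<ge> 0, k < 0\<close> and that of the Stirling cycle numbers
  for \<open>n < 0, k \<ge> 0\<close>; the remaining values are zero. The work lies in checking that these pieces
  fit together along the axes (\<open>harmonic_family_harmonic_number\<close>). By uniqueness, every
  harmonic family is this one, so the formulas hold for it by construction.
\<close>

text \<open>The coefficient of \<open>t\<^sup>k\<close> is \<open>h\<^sub>k(1, 1/2, ..., 1/n)\<close>.\<close>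

definition harmonic_multiset_number :: "nat \<Rightarrow> nat \<Rightarrow> rat" where
  "harmonic_multiset_number n k =
     fps_nth (\<Prod>j=1..n. 1 / (1 - fps_const (1 / of_nat j) * fps_X)) k"

text \<open>Multiplying the generating function by \<open>1 - t/(n+1)\<close> removes its last factor; comparing
  coefficients turns this into the recurrence in \<open>n\<close> and \<open>k\<close>.\<close>

lemma harmonic_multiset_gf_Suc:
  fixes n :: nat
  defines "F \<equiv> \<lambda>n. \<Prod>j=1..n. 1 / (1 - fps_const (1 / of_nat j :: rat) * fps_X)"
  shows "F (Suc n) * (1 - fps_const (1 / of_nat (Suc n)) * fps_X) = F n"
proof -
  let ?u = "1 - fps_const (1 / of_nat (Suc n) :: rat) * fps_X"
  have "1 / ?u * ?u = 1"
    by (simp add: fps_divide_unit inverse_mult_eq_1)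
  moreover have "F (Suc n) = F n * (1 / ?u)"
    unfolding F_def by (simp add: mult.commute)
  ultimately show ?thesis
    by (simp only: mult.assoc) simp
qed

lemma harmonic_multiset_number_0_right: "harmonic_multiset_number n 0 = 1"
proof (induction n)
  case 0
  then show ?case by (simp add: harmonic_multiset_number_def)
next
  case (Suc n)
  then show ?case
    using arg_cong[OF harmonic_multiset_gf_Suc[of n], of "\<lambda>f. fps_nth f 0"]
    by (simp add: harmonic_multiset_number_def)
qed

lemma harmonic_multiset_number_Suc_Suc:
  "of_nat (Suc n) * harmonic_multiset_number (Suc n) (Suc k) =
     of_nat (Suc n) * harmonic_multiset_number n (Suc k) + harmonic_multiset_number (Suc n) k"
proof -
  define F where "F = (\<lambda>n. \<Prod>j=1..n. 1 / (1 - fps_const (1 / of_nat j :: rat) * fps_X))"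
  have H: "harmonic_multiset_number n k = fps_nth (F n) k" for n k
    by (simp only: harmonic_multiset_number_def F_def)
  have "F n = F (Suc n) * (1 - fps_const (1 / of_nat (Suc n)) * fps_X)"
    unfolding F_def by (rule harmonic_multiset_gf_Suc[symmetric])
  also have "\<dots> = F (Suc n) - fps_const (1 / of_nat (Suc n)) * (fps_X * F (Suc n))"
    by (simp add: algebra_simps del: of_nat_Suc)
  finally have "fps_nth (F n) (Suc k) =
      fps_nth (F (Suc n) - fps_const (1 / of_nat (Suc n)) * (fps_X * F (Suc n))) (Suc k)"
    by simp
  then have "harmonic_multiset_number (Suc n) (Suc k)
      - 1 / of_nat (Suc n) * harmonic_multiset_number (Suc n) k = harmonic_multiset_number n (Suc k)"
    using H by (simp del: of_nat_Suc)
  then show ?thesis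
    by (simp add: field_simps del: of_nat_Suc)
qed

text \<open>The row \<open>n = 0\<close> must vanish, although the empty product would give the value \<open>1\<close> at
  \<open>k = 0\<close>; this is why the generating function is used for \<open>n \<ge> 1\<close> only.\<close>

definition harmonic_number :: "int \<Rightarrow> int \<Rightarrow> rat" where
  "harmonic_number n k =
     (if n \<ge> 0 then
        if k < 0 then (-1) ^ (nat n + 1) * fact (nat n) * of_nat (Stirling (nat (- k)) (nat n))
        else if n = 0 then 0
        else harmonic_multiset_number (nat n) (nat k)
      else if k < 0 then 0
      else of_nat (stirling (nat (- n)) (nat k)) / fact (nat (- n) - 1))"

lemma harmonic_number_pos_nonneg:
  "harmonic_number (int (Suc n)) (int k) = harmonic_multiset_number (Suc n) k"
  by (simp add: harmonic_number_def nat_add_distrib)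

lemma harmonic_number_nonneg_neg:
  "harmonic_number (int n) (- int (Suc m)) =
     (-1) ^ (n + 1) * fact n * of_nat (Stirling (Suc m) n)"
  by (simp add: harmonic_number_def nat_add_distrib del: Stirling.simps)

lemma harmonic_number_neg_nonneg:
  "harmonic_number (- int (Suc m)) (int k) = of_nat (stirling (Suc m) k) / fact m"
  by (simp add: harmonic_number_def nat_add_distrib del: stirling.simps)

lemma harmonic_number_neg_neg: "harmonic_number (- int (Suc m)) (- int (Suc p)) = 0"
  by (simp add: harmonic_number_def)

lemma harmonic_number_0_left: "harmonic_number 0 k = 0"
proof (cases "k < 0")
  case True
  then obtain m where "nat (- k) = Suc m"
    by (metis Suc_pred neg_0_less_iff_less zero_less_nat_eq)
  then show ?thesis using True by (simp add: harmonic_number_def)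
qed (simp add: harmonic_number_def)

lemma harmonic_number_minus_1_right: "harmonic_number n (-1) = (if n = 1 then 1 else 0)"
proof (cases n rule: int_cases)
  case (nonneg m)
  have "Stirling (Suc 0) m = (if m = 1 then 1 else 0)"
    by (cases m) (auto simp: Stirling.simps(2) split: nat.splits)
  then show ?thesis
    using nonneg harmonic_number_nonneg_neg[of m 0] by simp
next
  case (neg m)
  then show ?thesis using harmonic_number_neg_neg[of m 0] by simp
qed

lemma harmonic_number_minus_1_left: "harmonic_number (-1) k = (if k = 1 then 1 else 0)"
proof (cases k rule: int_cases)
  case (nonneg m)
  have "stirling (Suc 0) m = (if m = 1 then 1 else 0)"
    by (cases m) auto
  then show ?thesis
    using nonneg harmonic_number_neg_nonneg[of 0 m] by simp
next
  case (neg m)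
  then show ?thesis using harmonic_number_neg_neg[of 0 m] by simp
qed

lemma harmonic_number_rec:
  "of_int n * harmonic_number n k =
     of_int n * harmonic_number (n - 1) k + harmonic_number n (k - 1)"
proof (cases n rule: int_cases)
  case (nonneg m)
  show ?thesis
  proof (cases m)
    case 0
    then show ?thesis using nonneg by (simp add: harmonic_number_0_left)
  next
    case (Suc n')
    have n: "n = int (Suc n')" "n - 1 = int n'" using nonneg Suc by auto
    show ?thesis
    proof (cases k rule: int_cases)
      case k: (nonneg k')
      show ?thesis
      proof (cases k')
        case 0
        \<comment> \<open>The seam \<open>k = 0\<close>: the row \<open>n = 1\<close> takes its value from \<open>S(1,-1) = 1\<close>, all later
          rows from their predecessor.\<close>
        have "harmonic_number (int n') 0 = (if n' = 0 then 0 else 1)"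
          using harmonic_number_pos_nonneg[of "n' - 1" 0]
          by (cases n') (simp_all add: harmonic_number_0_left harmonic_multiset_number_0_right)
        moreover have "harmonic_number n 0 = 1"
          unfolding n(1) using harmonic_number_pos_nonneg[of n' 0]
          by (simp add: harmonic_multiset_number_0_right)
        ultimately show ?thesis
          unfolding n using k 0 by (simp add: harmonic_number_minus_1_right)
      next
        case k': (Suc p)
        have kk: "k = int (Suc p)" "k - 1 = int p" using k k' by auto
        \<comment> \<open>Away from \<open>k = 0\<close> the empty product has no coefficients, so it agrees with the
          zero row.\<close>
        have "harmonic_number (int n') (int (Suc p)) = harmonic_multiset_number n' (Suc p)"
          using harmonic_number_pos_nonneg[of "n' - 1" "Suc p"]
          by (cases n') (simp_all add: harmonic_number_0_left harmonic_multiset_number_def)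
        then show ?thesis
          using harmonic_multiset_number_Suc_Suc[of n' p]
          unfolding n(2) kk(2) unfolding n(1) kk(1) harmonic_number_pos_nonneg by simp
      qed
    next
      case (neg p)
      then have kk: "k = - int (Suc p)" "k - 1 = - int (Suc (Suc p))" by auto
      have "Stirling (Suc (Suc p)) (Suc n') =
          Suc n' * Stirling (Suc p) (Suc n') + Stirling (Suc p) n'"
        by (rule Stirling.simps(4))
      then show ?thesis
        unfolding n(2) kk(2) unfolding n(1) kk(1) harmonic_number_nonneg_neg
        by (simp add: algebra_simps del: Stirling.simps)
    qed
  qed
next
  case (neg m)
  then have n: "n = - int (Suc m)" "n - 1 = - int (Suc (Suc m))" by auto
  show ?thesis
  proof (cases k rule: int_cases)
    case k: (nonneg k')
    show ?thesis
    proof (cases k')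
      case 0
      then show ?thesis
        unfolding n(2) unfolding n(1)
        using k harmonic_number_neg_nonneg[of m 0] harmonic_number_neg_nonneg[of "Suc m" 0]
          harmonic_number_neg_neg[of m 0]
        by simp
    next
      case k': (Suc p)
      have kk: "k = int (Suc p)" "k - 1 = int p" using k k' by auto
      have "of_nat (Suc m) * (x / fact (Suc m)) = x / fact m" for x :: rat
        by simp
      then have "of_nat (Suc m) * (of_nat (stirling (Suc (Suc m)) (Suc p)) / fact (Suc m)) =
          (of_nat (Suc m * stirling (Suc m) (Suc p) + stirling (Suc m) p) / fact m :: rat)"
        unfolding stirling.simps(4)[of "Suc m" p] .
      then show ?thesis
        unfolding n(2) kk(2) unfolding n(1) kk(1) harmonic_number_neg_nonneg
        by (simp add: add_divide_distrib del: stirling.simps fact_Suc of_nat_Suc mult_Suc)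
    qed
  next
    case k: (neg p)
    then have kk: "k = - int (Suc p)" "k - 1 = - int (Suc (Suc p))" by auto
    show ?thesis unfolding n(2) kk(2) unfolding n(1) kk(1) harmonic_number_neg_neg by simp
  qed
qed

lemma harmonic_family_harmonic_number: "harmonic_family harmonic_number"
  unfolding harmonic_family_def
  using harmonic_number_rec harmonic_number_minus_1_right harmonic_number_minus_1_left by blast

text \<open>In a row \<open>n > 0\<close> whose predecessor vanishes the recursion becomes \<open>n D(n,k) = D(n,k-1)\<close>,
  so a single zero spreads over the whole row; for \<open>n < 0\<close> the recursion can be solved for
  \<open>D(n-1,k)\<close>.\<close>

lemma harmonic_recursion_homogeneous_eq_0:
  fixes D :: "int \<Rightarrow> int \<Rightarrow> rat"
  assumes rec: "\<And>n k. of_int n * D n k = of_int n * D (n - 1) k + D n (k - 1)"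
    and column: "\<And>n. D n (-1) = 0"
    and row: "\<And>k. D (-1) k = 0"
  shows "D n k = 0"
proof (cases "n \<ge> 0")
  case True
  then have "\<forall>k. D n k = 0"
  proof (induction n rule: int_ge_induct)
    case base
    show ?case
    proof
      fix k
      show "D 0 k = 0" using rec[of 0 "k + 1"] by simp
    qed
  next
    case (step n)
    have rec': "of_int (n + 1) * D (n + 1) k = D (n + 1) (k - 1)" for k
      using rec[of "n + 1" k] step.IH by simp
    have nz: "(of_int (n + 1) :: rat) \<noteq> 0" using step.hyps by linarith
    show ?case
    proof
      fix k
      show "D (n + 1) k = 0"
      proof (induction k rule: int_induct[where k = "-1"])
        case base
        show ?case by (rule column)
      next
        case (step1 i)
        then show ?case using rec'[of "i + 1"] nz by simp
      next
        case (step2 i)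
        then show ?case using rec'[of i] by simp
      qed
    qed
  qed
  then show ?thesis by simp
next
  case False
  then have "n \<le> -1" by simp
  then have "\<forall>k. D n k = 0"
  proof (induction n rule: int_le_induct)
    case base
    show ?case using row by simp
  next
    case (step n)
    then show ?case using rec[of n] by auto
  qed
  then show ?thesis by simp
qed

lemma harmonic_family_unique:
  assumes "harmonic_family S" and "harmonic_family T"
  shows "S = T"
proof (intro ext)
  fix n k
  have "S n k - T n k = 0"
    by (rule harmonic_recursion_homogeneous_eq_0[of "\<lambda>n k. S n k - T n k"])
      (use assms in \<open>simp_all add: harmonic_family_def right_diff_distrib\<close>)
  then show "S n k = T n k" by simp
qed

theorem theorem5p8:
  "(\<exists>!S. harmonic_family S) \<and>
   (\<forall>S. harmonic_family S \<longrightarrow>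
     (\<forall>(n::nat) (k::nat). n \<ge> 1 \<longrightarrow>
        S (int n) (int k) =
          fps_nth (\<Prod>j=1..n. 1 / (1 - fps_const (1 / of_nat j) * fps_X)) k \<and>
        of_nat (Stirling n k) = (-1) ^ (k + 1) / fact k * S (int k) (- int n) \<and>
        of_nat (stirling n k) = fact (n - 1) * S (- int n) (int k)))"
proof (intro conjI allI impI)
  show "\<exists>!S. harmonic_family S"
    using harmonic_family_harmonic_number harmonic_family_unique by blast
next
  fix S and n k :: nat
  assume "harmonic_family S" and "n \<ge> 1"
  then have S: "S = harmonic_number"
    using harmonic_family_harmonic_number harmonic_family_unique by blast
  obtain m where n: "n = Suc m" using \<open>n \<ge> 1\<close> by (cases n) auto
  show "S (int n) (int k) =
      fps_nth (\<Prod>j=1..n. 1 / (1 - fps_const (1 / of_nat j) * fps_X)) k"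
    unfolding S n harmonic_number_pos_nonneg by (rule harmonic_multiset_number_def)
  have "(-1 :: rat) ^ (k + 1) * (-1) ^ (k + 1) = 1"
    by (simp flip: power_mult_distrib)
  then show "of_nat (Stirling n k) = (-1) ^ (k + 1) / fact k * S (int k) (- int n)"
    unfolding S n harmonic_number_nonneg_neg by (simp add: field_simps del: Stirling.simps)
  show "of_nat (stirling n k) = fact (n - 1) * S (- int n) (int k)"
    unfolding S n harmonic_number_neg_nonneg by (simp del: stirling.simps)
qed

end
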